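(* Let $d\geq 1$ and let $\Xi_d\subset\mathbb{R}^d$ be the $d$-dimensional cross-polytope, i.e. the convex hull of $\pm\mathbf{e}_1,\ldots,\pm\mathbf{e}_d$, where $\mathbf{e}_1,\ldots,\mathbf{e}_d$ are the standard basis vectors. For an arbitrary $d$-tuple of integers $\mathbf{a}=(a_1,\ldots,a_d)\in\mathbb{Z}^d$, the refined Ehrhart series of $\Xi_d$ with weights $\mathbf{a}$ is $$E^{\mathbf{a}}_{\Xi_d}(t,q) = \frac{(1+t)^d(1-t)^{d-1}}{\displaystyle\prod_{j=1}^d(1-q^{a_j}t)\prod_{j=1}^d(1-q^{-a_j}t)}.$$
   Context: For a $d$-dimensional lattice polytope $\Sigma\subset\mathbb{R}^d$ (a compact convex polytope with vertices in $\mathbb{Z}^d$) and weights $\mathbf{a}=(a_1,\ldots,a_d)\in\mathbb{Z}^d$, let $r\Sigma$ denote the $r$-fold dilation of $\Sigma$ for an integer $r\geq 0$. For integers $k$ put $L^{\mathbf{a}}_\Sigma(r,k)=\#\{\mathbf{v}\in r\Sigma\cap\mathbb{Z}^d : \mathbf{v}\cdot\mathbf{a}=k\}$, where $\cdot$ is the standard inner product. The refined Ehrhart series is $$E^{\mathbf{a}}_\Sigma(t,q)=\sum_{r=0}^\infty\sum_{k\in\mathbb{Z}}L^{\mathbf{a}}_\Sigma(r,k)\,q^kt^r,$$ a formal power series in $t$ with coefficients in the Laurent polynomials $\mathbb{Z}[q,q^{-1}]$. Rational expressions are expanded as power series in $t$ over $\mathbb{Z}[q,q^{-1}]$. *)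

theory Defs
  imports
    "HOL-Analysis.Analysis"
    "HOL-Computational_Algebra.Formal_Power_Series"
    "HOL-Library.Poly_Mapping"
begin

text \<open>
  Laurent polynomials over the integers: finitely supported functions from exponents to
  coefficients. The multiplication of \<^type>\<open>poly_mapping\<close> is convolution, so this is the
  group ring of the infinite cyclic group.
\<close>

type_synonym laurent_poly = "int \<Rightarrow>\<^sub>0 int"

definition qpow :: "int \<Rightarrow> laurent_poly" where
  "qpow k = Poly_Mapping.single k 1"

definition integer_points :: "(real ^ 'n) set" where
  "integer_points = {v. \<forall>i. v $ i \<in> \<int>}"

definition dilate :: "nat \<Rightarrow> (real ^ 'n) set \<Rightarrow> (real ^ 'n) set" where
  "dilate r S = (\<lambda>x. real r *\<^sub>R x) ` S"

definition weighted_count :: "int ^ 'n \<Rightarrow> (real ^ 'n) set \<Rightarrow> nat \<Rightarrow> int \<Rightarrow> nat" where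
  "weighted_count a S r k =
     card {v \<in> dilate r S \<inter> integer_points. v \<bullet> (\<chi> i. of_int (a $ i)) = of_int k}"

text \<open>
  For bounded \<open>S\<close>, in particular for polytopes, the sets counted are finite and so is the
  support of the sum over \<open>k\<close>, so none of the default values of \<^const>\<open>card\<close> and
  \<^const>\<open>Sum_any\<close> on infinite sets is ever used; see \<open>lookup_refined_Ehrhart_series\<close> below.
\<close>

definition refined_Ehrhart_series :: "int ^ 'n \<Rightarrow> (real ^ 'n) set \<Rightarrow> laurent_poly fps" where
  "refined_Ehrhart_series a S =
     Abs_fps (\<lambda>r. Sum_any (\<lambda>k. of_nat (weighted_count a S r k) * qpow k))"

definition cross_polytope :: "(real ^ 'n) set" where
  "cross_polytope = convex hull (\<Union>i. {axis i 1, - axis i 1})"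

text \<open>
  The library's division on \<^type>\<open>fps\<close> needs an inverse operation on the coefficients, which
  Laurent polynomials lack. A denominator with constant term 1 is inverted here by the
  general recursion for one-sided inverses in the library.
\<close>

definition fps_quot :: "'a::comm_ring_1 fps \<Rightarrow> 'a fps \<Rightarrow> 'a fps" where
  "fps_quot P Q = P * fps_right_inverse Q 1"

lemma fps_quot_unique:
  fixes P Q E :: "'a::comm_ring_1 fps"
  assumes "fps_nth Q 0 = 1"
  shows "E = fps_quot P Q \<longleftrightarrow> E * Q = P"
proof -
  have Q: "Q * fps_right_inverse Q 1 = 1"
    using assms by (intro fps_right_inverse) simp
  show ?thesis
  proof
    assume E: "E = fps_quot P Q"
    have "E * Q = P * (Q * fps_right_inverse Q 1)"
      unfolding E fps_quot_def by (simp only: mult_ac)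
    then show "E * Q = P"
      by (simp only: Q mult_1_right)
  next
    assume P: "E * Q = P"
    have "fps_quot P Q = E * (Q * fps_right_inverse Q 1)"
      unfolding fps_quot_def P[symmetric] by (simp only: mult_ac)
    then show "E = fps_quot P Q"
      by (simp only: Q mult_1_right)
  qed
qed

lemma finite_bounded_integer_points:
  fixes S :: "(real ^ 'n) set"
  assumes "bounded S"
  shows "finite (dilate r S \<inter> integer_points)"
proof -
  have "bounded (dilate r S)"
    unfolding dilate_def using assms by (rule bounded_scaling)
  then obtain B where B: "\<And>x. x \<in> dilate r S \<Longrightarrow> norm x \<le> B"
    unfolding bounded_iff by blast
  let ?F = "(\<lambda>f. \<chi> i::'n. real_of_int (f i)) ` (UNIV \<rightarrow>\<^sub>E {- \<lceil>B\<rceil>..\<lceil>B\<rceil>})"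
  have "dilate r S \<inter> integer_points \<subseteq> ?F"
  proof
    fix v assume v: "v \<in> dilate r S \<inter> integer_points"
    have fl: "of_int \<lfloor>v $ i\<rfloor> = v $ i" for i
      using v by (simp add: integer_points_def)
    have "\<bar>v $ i\<bar> \<le> B" for i
      using B[of v] v component_le_norm_cart[of v i] by force
    then have "\<lfloor>v $ i\<rfloor> \<in> {- \<lceil>B\<rceil>..\<lceil>B\<rceil>}" for i
      using fl[of i] by (smt (verit) atLeastAtMost_iff le_of_int_ceiling of_int_le_iff of_int_minus)
    then have "(\<lambda>i. \<lfloor>v $ i\<rfloor>) \<in> UNIV \<rightarrow>\<^sub>E {- \<lceil>B\<rceil>..\<lceil>B\<rceil>}"
      by auto
    moreover have "v = (\<chi> i. of_int \<lfloor>v $ i\<rfloor>)"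
      unfolding vec_eq_iff vec_lambda_beta fl by simp
    ultimately show "v \<in> ?F"
      by (intro image_eqI[where x = "\<lambda>i. \<lfloor>v $ i\<rfloor>"])
  qed
  moreover have "finite ?F"
    by (intro finite_imageI finite_PiE) auto
  ultimately show ?thesis by (rule finite_subset)
qed

lemma lookup_refined_Ehrhart_series:
  fixes S :: "(real ^ 'n) set"
  assumes "bounded S"
  shows "Poly_Mapping.lookup (fps_nth (refined_Ehrhart_series a S) r) k
           = int (weighted_count a S r k)"
proof -
  let ?A = "dilate r S \<inter> integer_points"
  let ?w = "\<lambda>v :: real ^ 'n. v \<bullet> (\<chi> i. of_int (a $ i))"
  define K where "K = insert k ((\<lambda>v. \<lfloor>?w v\<rfloor>) ` ?A)"
  have fin: "finite K"
    unfolding K_def using finite_bounded_integer_points[OF assms] by blast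
  have kK: "k \<in> K"
    by (simp add: K_def)
  have zero: "weighted_count a S r j = 0" if "j \<notin> K" for j
  proof -
    have "{v \<in> ?A. ?w v = of_int j} = {}"
      using that unfolding K_def by force
    then show ?thesis
      by (simp only: weighted_count_def card.empty)
  qed
  have mono: "of_nat n * qpow j = Poly_Mapping.single j (int n)" for n j
  proof -
    have n: "(of_nat n :: laurent_poly) = Poly_Mapping.single 0 (int n)"
      by (metis single_of_nat)
    show ?thesis unfolding n qpow_def mult_single by simp
  qed
  have "Sum_any (\<lambda>j. of_nat (weighted_count a S r j) * qpow j)
      = (\<Sum>j\<in>K. Poly_Mapping.single j (int (weighted_count a S r j)))"
    unfolding mono
    by (rule Sum_any.expand_superset[OF fin]) (use zero in force)
  then have "Poly_Mapping.lookup (fps_nth (refined_Ehrhart_series a S) r) k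
      = (\<Sum>j\<in>K. if j = k then int (weighted_count a S r j) else 0)"
    by (simp add: refined_Ehrhart_series_def lookup_sum lookup_single when_def)
  also have "\<dots> = int (weighted_count a S r k)"
    using fin kK by simp
  finally show ?thesis .
qed

end

theory Submission
  imports Defs
begin

text \<open>
  The \<open>r\<close>-th dilation of the cross-polytope is the \<open>\<ell>\<^sub>1\<close>-ball of radius \<open>r\<close>, so the series is the
  sum of \<open>q ^ (\<Sum>i. a\<^sub>i * v\<^sub>i) * t ^ r\<close> over all lattice points \<open>v\<close> and all radii \<open>r\<close> that are
  at least the \<open>\<ell>\<^sub>1\<close>-norm of \<open>v\<close>. The \<open>\<ell>\<^sub>1\<close>-norm and the weight are both additive over the
  coordinates, hence this sum factors: each coordinate contributes
  \<open>\<Sum>m. q ^ (a\<^sub>i * m) * t ^ \<bar>m\<bar>\<close>, and the freedom in \<open>r\<close> contributes the factor \<open>1 / (1 - t)\<close>.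
  A two-sided geometric series of this kind is the sum of the two one-sided ones minus the
  doubly counted constant term, that is
  \<open>1 / (1 - q ^ a\<^sub>i * t) + 1 / (1 - q ^ (- a\<^sub>i) * t) - 1
    = (1 - t\<^sup>2) / ((1 - q ^ a\<^sub>i * t) * (1 - q ^ (- a\<^sub>i) * t))\<close>.
  The product over the coordinates has numerator \<open>(1 + t) ^ d * (1 - t) ^ d\<close>, and the factor
  \<open>1 / (1 - t)\<close> cancels one of the \<open>1 - t\<close>.

  The factorisation is \<open>gen_fun_insert\<close>, which adds one coordinate at a time to the generating
  function of balls; \<open>cross_polytope_eq\<close> and \<open>refined_Ehrhart_series_cross_polytope\<close> link it to
  the polytope.
\<close>

section \<open>The cross-polytope as a unit ball\<close>

lemma cross_polytope_eq:
  "(cross_polytope :: (real ^ 'n) set) = {x. (\<Sum>i\<in>UNIV. \<bar>x $ i\<bar>) \<le> 1}"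
proof
  have "convex {x :: real ^ 'n. (\<Sum>i\<in>UNIV. \<bar>x $ i\<bar>) \<le> 1}"
  proof (rule convexI, clarify)
    fix x y :: "real ^ 'n" and u v :: real
    assume x: "(\<Sum>i\<in>UNIV. \<bar>x $ i\<bar>) \<le> 1" and y: "(\<Sum>i\<in>UNIV. \<bar>y $ i\<bar>) \<le> 1"
      and u: "0 \<le> u" and v: "0 \<le> v" and uv: "u + v = 1"
    have "(\<Sum>i\<in>UNIV. \<bar>(u *\<^sub>R x + v *\<^sub>R y) $ i\<bar>) \<le> (\<Sum>i\<in>UNIV. u * \<bar>x $ i\<bar> + v * \<bar>y $ i\<bar>)"
    proof (rule sum_mono)
      fix i
      show "\<bar>(u *\<^sub>R x + v *\<^sub>R y) $ i\<bar> \<le> u * \<bar>x $ i\<bar> + v * \<bar>y $ i\<bar>"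
        using abs_triangle_ineq[of "u * x $ i" "v * y $ i"] u v by (simp add: abs_mult)
    qed
    also have "\<dots> = u * (\<Sum>i\<in>UNIV. \<bar>x $ i\<bar>) + v * (\<Sum>i\<in>UNIV. \<bar>y $ i\<bar>)"
      by (simp add: sum.distrib sum_distrib_left)
    also have "\<dots> \<le> u * 1 + v * 1"
      using u v x y by (intro add_mono mult_left_mono)
    finally show "(\<Sum>i\<in>UNIV. \<bar>(u *\<^sub>R x + v *\<^sub>R y) $ i\<bar>) \<le> 1"
      using uv by simp
  qed
  moreover have "(\<Sum>j\<in>UNIV. \<bar>axis i (1::real) $ j\<bar>) = 1" for i :: 'n
    by (simp add: axis_def if_distrib[of abs] cong: if_cong)
  ultimately show "(cross_polytope :: (real ^ 'n) set) \<subseteq> {x. (\<Sum>i\<in>UNIV. \<bar>x $ i\<bar>) \<le> 1}"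
    unfolding cross_polytope_def by (intro hull_minimal) auto
next
  let ?C = "cross_polytope :: (real ^ 'n) set"
  have convex: "convex ?C"
    by (simp add: cross_polytope_def)
  have vertex: "axis i 1 \<in> ?C" "- axis i 1 \<in> ?C" for i
    unfolding cross_polytope_def by (rule hull_inc, blast)+
  \<comment> \<open>The origin is the midpoint of any pair of opposite vertices.\<close>
  have zero: "0 \<in> ?C"
    using convexD[OF convex vertex(1)[of undefined] vertex(2)[of undefined], of "1/2" "1/2"]
    by simp
  show "{x. (\<Sum>i\<in>UNIV. \<bar>x $ i\<bar>) \<le> 1} \<subseteq> ?C"
  proof clarify
    fix x :: "real ^ 'n"
    assume le: "(\<Sum>i\<in>UNIV. \<bar>x $ i\<bar>) \<le> 1"
    define s where "s = (\<Sum>i\<in>UNIV. \<bar>x $ i\<bar>)"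
    define p where "p i = (if x $ i \<ge> 0 then axis i 1 else - axis i 1 :: real ^ 'n)" for i
    have s0: "s \<ge> 0"
      unfolding s_def by (simp add: sum_nonneg)
    have px: "(\<Sum>i\<in>UNIV. \<bar>x $ i\<bar> *\<^sub>R p i) = x"
    proof -
      have "\<bar>x $ i\<bar> *\<^sub>R p i = (x $ i) *s axis i 1" for i
        by (simp add: p_def vec_eq_iff)
      then show ?thesis by (simp add: basis_expansion)
    qed
    show "x \<in> ?C"
    proof (cases "s = 0")
      case True
      then have "x = 0"
        by (simp add: s_def sum_nonneg_eq_0_iff vec_eq_iff)
      then show ?thesis using zero by simp
    next
      case False
      \<comment> \<open>The weights \<open>\<bar>x\<^sub>i\<bar>\<close> add up to \<open>s \<le> 1\<close> only, so \<open>x\<close> is written as \<open>s\<close> times a genuine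
        convex combination of vertices plus \<open>1 - s\<close> times the origin.\<close>
      have "(\<Sum>i\<in>UNIV. (\<bar>x $ i\<bar> / s) *\<^sub>R p i) \<in> ?C"
        using False s0 vertex
        by (intro convex_sum[OF _ convex])
           (auto simp: p_def s_def simp flip: sum_divide_distrib)
      then have "s *\<^sub>R (\<Sum>i\<in>UNIV. (\<bar>x $ i\<bar> / s) *\<^sub>R p i) + (1 - s) *\<^sub>R 0 \<in> ?C"
        using s0 le zero by (intro convexD[OF convex]) (auto simp: s_def)
      then show ?thesis
        using False by (simp add: scaleR_right.sum px)
    qed
  qed
qed

lemma dilate_cross_polytope:
  "dilate r (cross_polytope :: (real ^ 'n) set) = {x. (\<Sum>i\<in>UNIV. \<bar>x $ i\<bar>) \<le> real r}"
proof (cases "r = 0")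
  case True
  have "(\<Sum>i\<in>UNIV. \<bar>x $ i\<bar>) \<le> 0 \<longleftrightarrow> x = 0" for x :: "real ^ 'n"
  proof -
    have "(\<Sum>i\<in>UNIV. \<bar>x $ i\<bar>) \<ge> 0"
      by (simp add: sum_nonneg)
    then have "(\<Sum>i\<in>UNIV. \<bar>x $ i\<bar>) \<le> 0 \<longleftrightarrow> (\<Sum>i\<in>UNIV. \<bar>x $ i\<bar>) = 0"
      by linarith
    then show ?thesis
      by (simp add: sum_nonneg_eq_0_iff vec_eq_iff)
  qed
  moreover have "(0 :: real ^ 'n) \<in> cross_polytope"
    by (simp add: cross_polytope_eq)
  ultimately show ?thesis
    using True by (auto simp: dilate_def)
next
  case False
  have "x \<in> dilate r cross_polytope \<longleftrightarrow> (1 / real r) *\<^sub>R x \<in> cross_polytope" for x :: "real ^ 'n"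
  proof
    assume "(1 / real r) *\<^sub>R x \<in> cross_polytope"
    then show "x \<in> dilate r cross_polytope"
      using False unfolding dilate_def by (intro image_eqI[of _ _ "(1 / real r) *\<^sub>R x"]) simp_all
  qed (use False in \<open>auto simp: dilate_def\<close>)
  also have "\<dots> x \<longleftrightarrow> (\<Sum>i\<in>UNIV. \<bar>x $ i\<bar>) \<le> real r" for x :: "real ^ 'n"
    using False by (simp add: cross_polytope_eq abs_mult divide_simps flip: sum_divide_distrib)
  finally show ?thesis by blast
qed

lemma bounded_cross_polytope: "bounded (cross_polytope :: (real ^ 'n) set)"
proof -
  have "(\<Union>i. {axis i 1, - axis i 1 :: real ^ 'n})
      = range (\<lambda>i. axis i 1) \<union> range (\<lambda>i. - axis i 1)"
    by blast
  then have "finite (\<Union>i. {axis i 1, - axis i 1 :: real ^ 'n})"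
    by simp
  then show ?thesis
    unfolding cross_polytope_def by (intro bounded_convex_hull finite_imp_bounded)
qed

section \<open>Two-sided geometric series\<close>

lemma qpow_0: "qpow 0 = 1"
  by (simp add: qpow_def)

lemma qpow_add: "qpow (i + j) = qpow i * qpow j"
  by (simp add: qpow_def mult_single)

lemma qpow_mult_nat: "qpow (b * int n) = qpow b ^ n"
  by (induction n) (simp_all add: qpow_0 qpow_add algebra_simps)

definition two_sided_geometric :: "int \<Rightarrow> laurent_poly fps" where
  "two_sided_geometric b = Abs_fps (\<lambda>n. \<Sum>m | \<bar>m\<bar> = int n. qpow (b * m))"

lemma geometric_fps:
  fixes c :: "'a::comm_ring_1"
  shows "Abs_fps (\<lambda>n. c ^ n) * (1 - fps_const c * fps_X) = 1" (is "?G * _ = 1")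
proof (rule fps_ext)
  fix n
  have "?G * (1 - fps_const c * fps_X) = ?G - ?G * fps_const c * fps_X"
    by (simp add: right_diff_distrib mult.assoc)
  then show "fps_nth (?G * (1 - fps_const c * fps_X)) n = fps_nth 1 n"
    by (cases n) (simp_all add: mult.commute[of c])
qed

text \<open>
  The indices \<open>m \<ge> 0\<close> and \<open>m \<le> 0\<close> give one-sided geometric series with ratios \<open>q ^ b * t\<close> and
  \<open>q ^ (- b) * t\<close>, which share the term \<open>m = 0\<close>. Clearing denominators leaves 1 minus the
  product \<open>t\<^sup>2\<close> of the two ratios.
\<close>

lemma two_sided_geometric_mult:
  "two_sided_geometric b * ((1 - fps_const (qpow b) * fps_X) * (1 - fps_const (qpow (- b)) * fps_X))
    = (1 + fps_X) * (1 - fps_X)"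
proof -
  let ?c = "fps_const (qpow b) * fps_X" and ?d = "fps_const (qpow (- b)) * fps_X"
  let ?G = "Abs_fps (\<lambda>n. qpow b ^ n)" and ?H = "Abs_fps (\<lambda>n. qpow (- b) ^ n)"
  have F: "two_sided_geometric b = ?G + ?H - 1"
  proof (rule fps_ext)
    fix n
    have "{m. \<bar>m\<bar> = int n} = {int n, - int n}"
      by auto
    moreover have "qpow (- (b * int n)) = qpow (- b) ^ n"
      using qpow_mult_nat[of "- b" n] by simp
    ultimately show "fps_nth (two_sided_geometric b) n = fps_nth (?G + ?H - 1) n"
      by (cases "n = 0") (auto simp: two_sided_geometric_def qpow_mult_nat qpow_0)
  qed
  have G: "?G * (1 - ?c) = 1" and H: "?H * (1 - ?d) = 1"
    by (rule geometric_fps)+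
  have "qpow b * qpow (- b) = 1"
    using qpow_add[of b "- b"] by (simp add: qpow_0)
  then have cd: "?c * ?d = fps_X * fps_X"
  proof -
    have "?c * ?d = (fps_const (qpow b) * fps_const (qpow (- b))) * (fps_X * fps_X)"
      by (simp only: mult_ac)
    then show ?thesis
      using \<open>qpow b * qpow (- b) = 1\<close> by simp
  qed
  have expand: "(g + h - 1) * ((1 - c) * (1 - d))
      = (g * (1 - c)) * (1 - d) + (h * (1 - d)) * (1 - c) - (1 - c) * (1 - d)"
    for c d g h :: "laurent_poly fps"
    by (simp add: algebra_simps)
  have "two_sided_geometric b * ((1 - ?c) * (1 - ?d))
      = (?G * (1 - ?c)) * (1 - ?d) + (?H * (1 - ?d)) * (1 - ?c) - (1 - ?c) * (1 - ?d)"
    unfolding F by (rule expand)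
  also have "\<dots> = 1 - ?c * ?d"
    unfolding G H by (simp add: algebra_simps)
  finally show ?thesis
    unfolding cd by (simp add: algebra_simps)
qed

section \<open>The generating function of lattice balls\<close>

text \<open>
  Only the coordinates in \<open>A\<close> may be nonzero. Letting \<open>A\<close> vary makes an induction on the
  dimension possible, since the type of the coordinates stays the same.
\<close>

definition lattice_ball :: "'i set \<Rightarrow> nat \<Rightarrow> ('i \<Rightarrow> int) set" where
  "lattice_ball A r = {f. (\<forall>i. i \<notin> A \<longrightarrow> f i = 0) \<and> (\<Sum>i\<in>A. \<bar>f i\<bar>) \<le> int r}"

definition gen_fun :: "('i \<Rightarrow> int) \<Rightarrow> 'i set \<Rightarrow> laurent_poly fps" where
  "gen_fun a A = Abs_fps (\<lambda>r. \<Sum>f\<in>lattice_ball A r. qpow (\<Sum>i\<in>A. a i * f i))"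

lemma lattice_ball_empty: "lattice_ball {} r = {\<lambda>_. 0}"
  by (auto simp: lattice_ball_def)

text \<open>
  A point of a ball is determined by its coordinate \<open>m\<close> at \<open>x\<close> and the remaining coordinates,
  which have the budget \<open>r - \<bar>m\<bar>\<close> left.
\<close>

lemma bij_betw_lattice_ball_insert:
  assumes A: "finite A" and x: "x \<notin> A"
  shows "bij_betw (\<lambda>(m, f). f(x := m))
           (SIGMA m:{- int r..int r}. lattice_ball A (r - nat \<bar>m\<bar>)) (lattice_ball (insert x A) r)"
proof (rule bij_betw_byWitness[where f' = "\<lambda>f. (f x, f(x := 0))"])
  have upd: "(\<Sum>i\<in>A. \<bar>(f(x := m)) i\<bar>) = (\<Sum>i\<in>A. \<bar>f i\<bar>)" for f :: "'a \<Rightarrow> int" and m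
    using x by (intro sum.cong) auto
  show "(\<lambda>(m, f). f(x := m)) ` (SIGMA m:{- int r..int r}. lattice_ball A (r - nat \<bar>m\<bar>))
      \<subseteq> lattice_ball (insert x A) r"
    using A x by (auto simp: lattice_ball_def upd simp del: fun_upd_apply) (auto simp: algebra_simps)
  show "(\<lambda>f. (f x, f(x := 0))) ` lattice_ball (insert x A) r
      \<subseteq> (SIGMA m:{- int r..int r}. lattice_ball A (r - nat \<bar>m\<bar>))"
  proof clarify
    fix f assume f: "f \<in> lattice_ball (insert x A) r"
    then have le: "\<bar>f x\<bar> + (\<Sum>i\<in>A. \<bar>f i\<bar>) \<le> int r"
      using A x by (simp add: lattice_ball_def)
    moreover have "(\<Sum>i\<in>A. \<bar>f i\<bar>) \<ge> 0"
      by (simp add: sum_nonneg)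
    ultimately have m: "\<bar>f x\<bar> \<le> int r" and "(\<Sum>i\<in>A. \<bar>f i\<bar>) \<le> int (r - nat \<bar>f x\<bar>)"
      by linarith+
    then have "f(x := 0) \<in> lattice_ball A (r - nat \<bar>f x\<bar>)"
      using f unfolding lattice_ball_def mem_Collect_eq upd by auto
    then show "f x \<in> {- int r..int r} \<and> f(x := 0) \<in> lattice_ball A (r - nat \<bar>f x\<bar>)"
      using m by auto
  qed
qed (use x in \<open>auto simp: lattice_ball_def fun_eq_iff\<close>)

lemma finite_lattice_ball: "finite A \<Longrightarrow> finite (lattice_ball A r)"
proof (induction A arbitrary: r rule: finite_induct)
  case empty
  then show ?case by (simp add: lattice_ball_empty)
next
  case (insert x A)
  then show ?case
    using bij_betw_finite[OF bij_betw_lattice_ball_insert[OF insert.hyps, of r]] by simp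
qed

text \<open>
  Norm and weight are additive, so a further coordinate acts on the generating function as a
  Cauchy product: the part \<open>\<bar>m\<bar>\<close> of the radius is spent on that coordinate and
  the rest on the others.
\<close>

lemma gen_fun_insert:
  assumes A: "finite A" and x: "x \<notin> A"
  shows "gen_fun a (insert x A) = two_sided_geometric (a x) * gen_fun a A"
proof (rule fps_ext)
  fix r
  let ?B = "\<lambda>n. \<Sum>f\<in>lattice_ball A n. qpow (\<Sum>i\<in>A. a i * f i)"
  have "fps_nth (gen_fun a (insert x A)) r
      = (\<Sum>(m, f)\<in>(SIGMA m:{- int r..int r}. lattice_ball A (r - nat \<bar>m\<bar>)).
           qpow (\<Sum>i\<in>insert x A. a i * (f(x := m)) i))"
    unfolding gen_fun_def fps_nth_Abs_fps
    by (subst sum.reindex_bij_betw[OF bij_betw_lattice_ball_insert[OF A x], symmetric])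
       (simp add: case_prod_unfold)
  also have "\<dots> = (\<Sum>(m, f)\<in>(SIGMA m:{- int r..int r}. lattice_ball A (r - nat \<bar>m\<bar>)).
           qpow (a x * m) * qpow (\<Sum>i\<in>A. a i * f i))"
  proof (intro sum.cong refl, clarify)
    fix m :: int and f :: "'a \<Rightarrow> int"
    have "(\<Sum>i\<in>A. a i * (f(x := m)) i) = (\<Sum>i\<in>A. a i * f i)"
      using x by (intro sum.cong) auto
    then show "qpow (\<Sum>i\<in>insert x A. a i * (f(x := m)) i)
        = qpow (a x * m) * qpow (\<Sum>i\<in>A. a i * f i)"
      using A x by (simp add: qpow_add del: fun_upd_apply) simp
  qed
  also have "\<dots> = (\<Sum>m\<in>{- int r..int r}. qpow (a x * m) * ?B (r - nat \<bar>m\<bar>))"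
    by (subst sum.Sigma[symmetric]) (simp_all add: finite_lattice_ball A sum_distrib_left)
  also have "\<dots> = (\<Sum>n\<in>{0..r}. \<Sum>m | m \<in> {- int r..int r} \<and> nat \<bar>m\<bar> = n.
           qpow (a x * m) * ?B (r - nat \<bar>m\<bar>))"
    by (rule sum.group[symmetric]) auto
  also have "\<dots> = (\<Sum>n\<in>{0..r}. (\<Sum>m | \<bar>m\<bar> = int n. qpow (a x * m)) * ?B (r - n))"
  proof (rule sum.cong[OF refl])
    fix n assume "n \<in> {0..r}"
    then have "{m. m \<in> {- int r..int r} \<and> nat \<bar>m\<bar> = n} = {m. \<bar>m\<bar> = int n}"
      by auto
    then show "(\<Sum>m | m \<in> {- int r..int r} \<and> nat \<bar>m\<bar> = n. qpow (a x * m) * ?B (r - nat \<bar>m\<bar>))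
        = (\<Sum>m | \<bar>m\<bar> = int n. qpow (a x * m)) * ?B (r - n)"
      unfolding sum_distrib_right by (intro sum.cong) auto
  qed
  also have "\<dots> = fps_nth (two_sided_geometric (a x) * gen_fun a A) r"
    by (simp add: fps_mult_nth two_sided_geometric_def gen_fun_def)
  finally show "fps_nth (gen_fun a (insert x A)) r
      = fps_nth (two_sided_geometric (a x) * gen_fun a A) r" .
qed

text \<open>
  In dimension zero every radius admits exactly the origin, which gives the series \<open>1 / (1 - t)\<close>.
\<close>

lemma gen_fun_eq:
  assumes "finite A"
  shows "gen_fun a A = Abs_fps (\<lambda>_. 1) * (\<Prod>i\<in>A. two_sided_geometric (a i))"
  using assms
proof (induction A rule: finite_induct)
  case empty
  then show ?case by (simp add: gen_fun_def lattice_ball_empty qpow_0)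
next
  case (insert x A)
  then show ?case by (simp add: gen_fun_insert mult_ac)
qed

section \<open>The refined Ehrhart series\<close>

lemma weighted_count_cross_polytope:
  fixes a :: "int ^ 'n"
  shows "weighted_count a (cross_polytope :: (real ^ 'n) set) r k
    = card {f \<in> lattice_ball UNIV r. (\<Sum>i\<in>UNIV. a $ i * f i) = k}"
proof -
  let ?V = "{v \<in> dilate r (cross_polytope :: (real ^ 'n) set) \<inter> integer_points.
               v \<bullet> (\<chi> i. of_int (a $ i)) = of_int k}"
  let ?F = "{f \<in> lattice_ball UNIV r. (\<Sum>i\<in>UNIV. a $ i * f i) = k}"
  let ?e = "\<lambda>f. (\<chi> i. of_int (f i)) :: real ^ 'n"
  have norm: "(\<Sum>i\<in>UNIV. \<bar>?e f $ i\<bar>) \<le> real r \<longleftrightarrow> (\<Sum>i\<in>UNIV. \<bar>f i\<bar>) \<le> int r" for f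
  proof -
    have "(\<Sum>i\<in>UNIV. \<bar>?e f $ i\<bar>) = of_int (\<Sum>i\<in>UNIV. \<bar>f i\<bar>)"
      by simp
    then show ?thesis by (metis of_int_le_iff of_int_of_nat_eq)
  qed
  have weight: "?e f \<bullet> (\<chi> i. of_int (a $ i)) = of_int k \<longleftrightarrow> (\<Sum>i\<in>UNIV. a $ i * f i) = k" for f
  proof -
    have "?e f \<bullet> (\<chi> i. of_int (a $ i)) = of_int (\<Sum>i\<in>UNIV. a $ i * f i)"
      by (simp add: inner_vec_def mult.commute)
    then show ?thesis by (simp only: of_int_eq_iff)
  qed
  have mem: "?e f \<in> ?V \<longleftrightarrow> f \<in> ?F" for f
    unfolding mem_Collect_eq Int_iff dilate_cross_polytope norm weight
    by (simp add: integer_points_def lattice_ball_def)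
  have "?V = ?e ` ?F"
  proof
    show "?V \<subseteq> ?e ` ?F"
    proof
      fix v assume v: "v \<in> ?V"
      then have "v $ i \<in> \<int>" for i
        by (simp add: integer_points_def)
      then have eq: "v = ?e (\<lambda>i. \<lfloor>v $ i\<rfloor>)"
        by (simp add: vec_eq_iff)
      then have "?e (\<lambda>i. \<lfloor>v $ i\<rfloor>) \<in> ?V"
        using v by (rule subst[where P = "\<lambda>w. w \<in> ?V"])
      with eq show "v \<in> ?e ` ?F"
        unfolding mem by (rule image_eqI)
    qed
  qed (use mem in blast)
  moreover have "inj ?e"
    by (rule injI) (simp add: vec_eq_iff fun_eq_iff)
  then have "inj_on ?e ?F"
    by (rule inj_on_subset) simp
  ultimately show ?thesis
    unfolding weighted_count_def by (simp only: card_image)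
qed

lemma refined_Ehrhart_series_cross_polytope:
  fixes a :: "int ^ 'n"
  shows "refined_Ehrhart_series a (cross_polytope :: (real ^ 'n) set) = gen_fun (($) a) UNIV"
proof (rule fps_ext, rule poly_mapping_eqI)
  fix r k
  have "Poly_Mapping.lookup (fps_nth (gen_fun (($) a) UNIV) r) k
      = (\<Sum>f\<in>lattice_ball UNIV r. if (\<Sum>i\<in>UNIV. a $ i * f i) = k then 1 else 0)"
    by (auto simp: gen_fun_def qpow_def lookup_sum lookup_single when_def intro!: sum.cong)
  also have "\<dots> = int (card {f \<in> lattice_ball UNIV r. (\<Sum>i\<in>UNIV. a $ i * f i) = k})"
    by (simp add: finite_lattice_ball flip: sum.inter_filter)
  finally show "Poly_Mapping.lookup (fps_nth (refined_Ehrhart_series a cross_polytope) r) k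
      = Poly_Mapping.lookup (fps_nth (gen_fun (($) a) UNIV) r) k"
    by (simp add: lookup_refined_Ehrhart_series bounded_cross_polytope
        weighted_count_cross_polytope)
qed

theorem proposition2p2:
  fixes a :: "int ^ 'n"
  shows "refined_Ehrhart_series a (cross_polytope :: (real ^ 'n) set) =
    fps_quot ((1 + fps_X) ^ CARD('n) * (1 - fps_X) ^ (CARD('n) - 1))
      ((\<Prod>j\<in>UNIV. 1 - fps_const (qpow (a $ j)) * fps_X) *
       (\<Prod>j\<in>UNIV. 1 - fps_const (qpow (- (a $ j))) * fps_X))"
    (is "_ = fps_quot ?P (?Q1 * ?Q2)")
proof -
  let ?one = "Abs_fps (\<lambda>_. 1) :: laurent_poly fps"
  have "fps_nth (\<Prod>j\<in>A. 1 - fps_const (c j) * fps_X) 0 = 1"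
    for A :: "'n set" and c :: "'n \<Rightarrow> laurent_poly"
    by (induction A rule: infinite_finite_induct) simp_all
  then have Q0: "fps_nth (?Q1 * ?Q2) 0 = 1"
    by simp
  have geo: "?one * (1 - fps_X) = 1"
    using geometric_fps[of "1 :: laurent_poly"] by simp
  have card: "CARD('n) = Suc (CARD('n) - 1)"
    by simp
  have "gen_fun (($) a) UNIV * (?Q1 * ?Q2)
      = ?one * (\<Prod>j\<in>UNIV. two_sided_geometric (a $ j) *
          ((1 - fps_const (qpow (a $ j)) * fps_X) * (1 - fps_const (qpow (- (a $ j))) * fps_X)))"
    by (simp add: gen_fun_eq prod.distrib mult_ac)
  also have "\<dots> = ?one * ((1 + fps_X) ^ CARD('n) * (1 - fps_X) ^ CARD('n))"
    unfolding two_sided_geometric_mult by (simp add: power_mult_distrib)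
  also have "\<dots> = (?one * (1 - fps_X)) * ?P"
    by (subst (2) card) (simp only: power_Suc mult_ac)
  also have "\<dots> = ?P"
    unfolding geo by simp
  finally show ?thesis
    unfolding refined_Ehrhart_series_cross_polytope fps_quot_unique[OF Q0] .
qed

end
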